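(* Let $\mathcal{S}$ be a probabilistic transition system, let $T$ be a search of $\mathcal{S}$, and let $\phi$ be an LTL$_+$ formula. If $T$ has not found a violation of $\phi$, then \[ \mu_{\mathcal{S}_T}\bigl(\mathcal{B}^{\phi}_{\mathcal{S}_T}(T)\bigr)=\mu_{\mathcal{S}_T}\bigl(\{\, e\in\mathrm{Exec}_{\mathcal{S}_T}\mid e\models_{\mathcal{S}_T}\phi\,\}\bigr). \]
   Context: A probabilistic transition system (PTS) $\mathcal{S}$ consists of a countable set $S_{\mathcal{S}}$ of states, a countable set $T_{\mathcal{S}}$ of transitions, a set $AP$ of atomic propositions, an initial state $s_0\in S_{\mathcal{S}}$, functions $\mathrm{source}_{\mathcal{S}},\mathrm{target}_{\mathcal{S}}:T_{\mathcal{S}}\to S_{\mathcal{S}}$, $\mathrm{prob}_{\mathcal{S}}:T_{\mathcal{S}}\to(0,1]$ and $\mathrm{label}_{\mathcal{S}}:S_{\mathcal{S}}\to 2^{AP}$, such that for every $s$, $\sum\{\mathrm{prob}_{\mathcal{S}}(t)\mid \mathrm{source}_{\mathcal{S}}(t)=s\}=1$. An execution path is an infinite sequence $t_1t_2\ldots$ of transitions with $\mathrm{source}(t_1)=s_0$ and $\mathrm{target}(t_i)=\mathrm{source}(t_{i+1})$; $\mathrm{Exec}_{\mathcal{S}}$ is the set of execution paths. For a finite sequence $e$ of transitions, $B^e_{\mathcal{S}}$ is the set of execution paths having $e$ as a prefix. $\mu_{\mathcal{S}}$ is the probability measure on the $\sigma$-algebra generated by these sets with $\mu_{\mathcal{S}}(B^{t_1\ldots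 t_n}_{\mathcal{S}})=\prod_{i=1}^n\mathrm{prob}_{\mathcal{S}}(t_i)$ for finite prefixes of execution paths. The trace of $t_1t_2\ldots$ is $\mathrm{label}(\mathrm{source}(t_1))\,\mathrm{label}(\mathrm{source}(t_2))\ldots$; for a linear-time property $\phi$ (set of infinite words over $2^{AP}$; LTL formulas identified with their sets of models), $e\models_{\mathcal{S}}\phi$ means the trace of $e$ satisfies $\phi$. A search of $\mathcal{S}$ is a finite subset $T\subseteq T_{\mathcal{S}}$. A PTS $\mathcal{S}'$ extends the search $T$ of $\mathcal{S}$ if it has the same initial state and every $t\in T$ is a transition of $\mathcal{S}'$ with the same source, target and probability as in $\mathcal{S}$, with the labels of its source and target unchanged. For such $\mathcal{S}'$, $\mathcal{B}^{\phi}_{\mathcal{S}'}(T)=\bigcup\{B^e_{\mathcal{S}'}\mid e\in T^*,\ \forall e'\in B^e_{\mathcal{S}'}: e'\models_{\mathcal{S}'}\phi\}$. The search $T$ has not found a violation of $\phi$ if there is a PTS $\mathcal{S}'$ extending $T$ of $\mathcal{S}$ such that $e\models_{\mathcal{S}'}\phi$ for all $e\in\mathrm{Exec}_{\mathcal{S}'}$. The PTS $\mathcal{S}_T$: with $S^T=\{\mathrm{source}_{\mathcal{S}}(t),\mathrm{target}_{\mathcal{S}}(t)\mid t\in T\}\cup\{s_0\}$ and $\mathrm{out}(s)=\sum\{\mathrm{prob}_{\mathcal{S}}(t)\mid t\in T,\ \mathrm{source}_{\mathcal{S}}(t)=s\}$, $\mathcal{S}_T$ has states $S^T\cup\{s_\perp\}$,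 transitions $T\cup\{t_s\mid s\in S^T,\ \mathrm{out}(s)<1\}\cup\{t_\perp\}$, initial state $s_0$; transitions in $T$ keep their data from $\mathcal{S}$; $t_s$ goes from $s$ to $s_\perp$ with probability $1-\mathrm{out}(s)$; $t_\perp$ is a self-loop on $s_\perp$ with probability $1$; $\mathrm{label}(s_\perp)=\emptyset$, other labels as in $\mathcal{S}$. LTL$_+$ formulas: $\phi::=\mathrm{true}\mid\mathrm{false}\mid a\mid\phi\wedge\phi\mid\phi\vee\phi\mid\bigcirc\phi\mid\phi_1\mathbin{\mathcal{U}}\phi_2\mid\phi_1\mathbin{\mathcal{R}}\phi_2$ with $a\in AP$, standard LTL semantics. *)

theory Defs
  imports "HOL-Probability.Probability" "HOL-Library.Stream"
begin

text \<open>
  The type \<open>'a\<close> plays the role of the set of atomic propositions. States and transitions are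
  sets inside the types \<open>'s\<close> and \<open>'t\<close>; the values of the functions outside these sets are
  irrelevant.
\<close>

record ('s, 't, 'a) pts =
  states :: "'s set"
  transitions :: "'t set"
  initial :: 's
  source :: "'t \<Rightarrow> 's"
  target :: "'t \<Rightarrow> 's"
  prob :: "'t \<Rightarrow> real"
  label :: "'s \<Rightarrow> 'a set"

definition is_pts :: "('s, 't, 'a) pts \<Rightarrow> bool" where
  "is_pts S \<longleftrightarrow>
     countable (states S) \<and> countable (transitions S) \<and>
     initial S \<in> states S \<and>
     (\<forall>t\<in>transitions S. source S t \<in> states S \<and> target S t \<in> states S \<and>
        0 < prob S t \<and> prob S t \<le> 1) \<and>
     (\<forall>s\<in>states S. (prob S has_sum 1) {t \<in> transitions S. source S t = s})"

definition Exec :: "('s, 't, 'a) pts \<Rightarrow> 't stream set" where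
  "Exec S = {w. sset w \<subseteq> transitions S \<and> source S (shd w) = initial S \<and>
     (\<forall>i. target S (w !! i) = source S (w !! Suc i))}"

definition cyl :: "('s, 't, 'a) pts \<Rightarrow> 't list \<Rightarrow> 't stream set" where
  "cyl S e = {w \<in> Exec S. stake (length e) w = e}"

definition finite_prefixes :: "('s, 't, 'a) pts \<Rightarrow> 't list set" where
  "finite_prefixes S = {stake n w | n w. w \<in> Exec S}"

text \<open>
  The sequences that are not prefixes of an execution path have an empty cylinder, so leaving
  them out does not change the generated sigma-algebra (lemma \<open>sets_path_measure\<close> below). The
  default case of \<^const>\<open>extend_measure\<close> does not occur: lemmas \<open>emeasure_path_measure_cyl\<close> and
  \<open>prob_space_path_measure\<close>.
\<close>

definition path_measure :: "('s, 't, 'a) pts \<Rightarrow> 't stream measure" where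
  "path_measure S = extend_measure (Exec S) (finite_prefixes S) (cyl S)
     (\<lambda>e. ennreal (\<Prod>t\<leftarrow>e. prob S t))"

definition path_trace :: "('s, 't, 'a) pts \<Rightarrow> 't stream \<Rightarrow> 'a set stream" where
  "path_trace S w = smap (\<lambda>t. label S (source S t)) w"

definition satisfies :: "('s, 't, 'a) pts \<Rightarrow> 't stream \<Rightarrow> 'a set stream set \<Rightarrow> bool" where
  "satisfies S w P \<longleftrightarrow> path_trace S w \<in> P"

definition is_search :: "('s, 't, 'a) pts \<Rightarrow> 't set \<Rightarrow> bool" where
  "is_search S T \<longleftrightarrow> finite T \<and> T \<subseteq> transitions S"

text \<open>
  Two systems need not live in the same types. The embeddings \<open>i\<close> and \<open>j\<close>, always injective
  where this is used, identify the states and transitions of \<open>S\<close> with elements of the types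
  of \<open>S'\<close>.
\<close>

definition extends_via ::
  "('s \<Rightarrow> 's2) \<Rightarrow> ('t \<Rightarrow> 't2) \<Rightarrow> ('s, 't, 'a) pts \<Rightarrow> 't set \<Rightarrow> ('s2, 't2, 'a) pts \<Rightarrow> bool" where
  "extends_via i j S T S' \<longleftrightarrow>
     initial S' = i (initial S) \<and>
     (\<forall>t\<in>T. j t \<in> transitions S' \<and>
        source S' (j t) = i (source S t) \<and>
        target S' (j t) = i (target S t) \<and>
        prob S' (j t) = prob S t \<and>
        label S' (i (source S t)) = label S (source S t) \<and>
        label S' (i (target S t)) = label S (target S t))"

definition good_paths :: "('s, 't, 'a) pts \<Rightarrow> 't set \<Rightarrow> 'a set stream set \<Rightarrow> 't stream set" where
  "good_paths S' T P = \<Union>{cyl S' e | e. e \<in> lists T \<and> (\<forall>w\<in>cyl S' e. satisfies S' w P)}"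

text \<open>
  An extension may need states and transitions that do not exist in \<open>S\<close>. Since these are
  countably many, the types \<open>'s + nat\<close> and \<open>'t + nat\<close> have room for every extension up to
  isomorphism (lemma \<open>no_violation_foundI\<close> below).
\<close>

definition no_violation_found :: "('s, 't, 'a) pts \<Rightarrow> 't set \<Rightarrow> 'a set stream set \<Rightarrow> bool" where
  "no_violation_found S T P \<longleftrightarrow>
     (\<exists>S' :: ('s + nat, 't + nat, 'a) pts. is_pts S' \<and> extends_via Inl Inl S T S' \<and>
        (\<forall>w\<in>Exec S'. satisfies S' w P))"

definition search_states :: "('s, 't, 'a) pts \<Rightarrow> 't set \<Rightarrow> 's set" where
  "search_states S T = source S ` T \<union> target S ` T \<union> {initial S}"

definition out_prob :: "('s, 't, 'a) pts \<Rightarrow> 't set \<Rightarrow> 's \<Rightarrow> real" where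
  "out_prob S T s = (\<Sum>t | t \<in> T \<and> source S t = s. prob S t)"

text \<open>
  The state \<open>None\<close> is the additional sink; \<open>Missing s\<close> is the transition from \<open>s\<close> to the sink
  and \<open>Sink_Loop\<close> the self-loop on the sink.
\<close>

datatype ('s, 't) search_trans = Found 't | Missing 's | Sink_Loop

definition search_pts :: "('s, 't, 'a) pts \<Rightarrow> 't set \<Rightarrow> ('s option, ('s, 't) search_trans, 'a) pts" where
  "search_pts S T = \<lparr>
     states = Some ` search_states S T \<union> {None},
     transitions = Found ` T \<union> {Missing s | s. s \<in> search_states S T \<and> out_prob S T s < 1}
       \<union> {Sink_Loop},
     initial = Some (initial S),
     source = (\<lambda>u. case u of Found t \<Rightarrow> Some (source S t) | Missing s \<Rightarrow> Some s
       | Sink_Loop \<Rightarrow> None),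
     target = (\<lambda>u. case u of Found t \<Rightarrow> Some (target S t) | Missing s \<Rightarrow> None
       | Sink_Loop \<Rightarrow> None),
     prob = (\<lambda>u. case u of Found t \<Rightarrow> prob S t | Missing s \<Rightarrow> 1 - out_prob S T s
       | Sink_Loop \<Rightarrow> 1),
     label = (\<lambda>s. case s of Some s' \<Rightarrow> label S s' | None \<Rightarrow> {}) \<rparr>"

datatype 'a ltl_pos =
    LTrue
  | LFalse
  | LAtom 'a
  | LAnd "'a ltl_pos" "'a ltl_pos"
  | LOr "'a ltl_pos" "'a ltl_pos"
  | LNext "'a ltl_pos"
  | LUntil "'a ltl_pos" "'a ltl_pos"
  | LRelease "'a ltl_pos" "'a ltl_pos"

primrec ltl_sat :: "'a ltl_pos \<Rightarrow> 'a set stream \<Rightarrow> bool" where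
  "ltl_sat LTrue x \<longleftrightarrow> True"
| "ltl_sat LFalse x \<longleftrightarrow> False"
| "ltl_sat (LAtom a) x \<longleftrightarrow> a \<in> shd x"
| "ltl_sat (LAnd f g) x \<longleftrightarrow> ltl_sat f x \<and> ltl_sat g x"
| "ltl_sat (LOr f g) x \<longleftrightarrow> ltl_sat f x \<or> ltl_sat g x"
| "ltl_sat (LNext f) x \<longleftrightarrow> ltl_sat f (stl x)"
| "ltl_sat (LUntil f g) x \<longleftrightarrow> (\<exists>k. ltl_sat g (sdrop k x) \<and> (\<forall>l<k. ltl_sat f (sdrop l x)))"
| "ltl_sat (LRelease f g) x \<longleftrightarrow> (\<forall>k. ltl_sat g (sdrop k x) \<or> (\<exists>l<k. ltl_sat f (sdrop l x)))"

definition models :: "'a ltl_pos \<Rightarrow> 'a set stream set" where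
  "models f = {x. ltl_sat f x}"

lemma is_pts_search_pts:
  assumes S: "is_pts S" and T: "is_search S T"
  shows "is_pts (search_pts S T)"
proof -
  have finT: "finite T" and subT: "T \<subseteq> transitions S" using T by (auto simp: is_search_def)
  have finS: "finite (search_states S T)" using finT by (simp add: search_states_def)
  have nonneg: "0 \<le> out_prob S T s" for s
    unfolding out_prob_def using S subT by (intro sum_nonneg) (force simp: is_pts_def)
  have le1: "out_prob S T s \<le> 1" if s: "s \<in> states S" for s
  proof -
    have "(prob S has_sum out_prob S T s) {t. t \<in> T \<and> source S t = s}"
      unfolding out_prob_def using finT by (intro has_sum_finite) auto
    moreover have "(prob S has_sum 1) {t \<in> transitions S. source S t = s}"
      using S s by (simp add: is_pts_def)
    ultimately show ?thesis
      by (rule has_sum_mono_neutral) (use subT S in \<open>auto simp: is_pts_def intro: less_imp_le\<close>)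
  qed
  have sub: "search_states S T \<subseteq> states S"
    using S subT by (auto simp: search_states_def is_pts_def)
  have main: "(prob (search_pts S T) has_sum 1)
      {u \<in> transitions (search_pts S T). source (search_pts S T) u = Some s}"
    if s: "s \<in> search_states S T" for s
  proof -
    let ?F = "Found ` {t. t \<in> T \<and> source S t = s}"
    have sumF: "(\<Sum>u\<in>?F. prob (search_pts S T) u) = out_prob S T s"
      unfolding out_prob_def by (subst sum.reindex) (auto simp: search_pts_def inj_on_def)
    have finF: "finite ?F" using finT by auto
    show ?thesis
    proof (cases "out_prob S T s < 1")
      case True
      have eq: "{u \<in> transitions (search_pts S T). source (search_pts S T) u = Some s}
          = insert (Missing s) ?F"
        using True s by (auto simp: search_pts_def)
      have one: "(\<Sum>u\<in>insert (Missing s) ?F. prob (search_pts S T) u) = 1"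
        using finF sumF by (subst sum.insert) (auto simp: search_pts_def)
      have "finite (insert (Missing s) ?F)" using finF by simp
      from has_sum_finite[OF this, of "prob (search_pts S T)"] show ?thesis
        unfolding eq one .
    next
      case False
      then have one: "out_prob S T s = 1" using le1 s sub by force
      have eq: "{u \<in> transitions (search_pts S T). source (search_pts S T) u = Some s} = ?F"
        using False s by (auto simp: search_pts_def)
      from has_sum_finite[OF finF, of "prob (search_pts S T)"] show ?thesis
        unfolding eq sumF one .
    qed
  qed
  have sink: "(prob (search_pts S T) has_sum 1)
      {u \<in> transitions (search_pts S T). source (search_pts S T) u = None}"
  proof -
    have eq: "{u \<in> transitions (search_pts S T). source (search_pts S T) u = None} = {Sink_Loop}"
      by (auto simp: search_pts_def)
    show ?thesis unfolding eq
      using has_sum_finite[of "{Sink_Loop}" "prob (search_pts S T)"] by (simp add: search_pts_def)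
  qed
  have "countable {Missing s | s. s \<in> search_states S T \<and> out_prob S T s < 1}"
    using finS by (intro countable_finite) auto
  then have "countable (transitions (search_pts S T))"
    using finT by (simp add: search_pts_def countable_finite)
  moreover have "\<forall>u\<in>transitions (search_pts S T).
      source (search_pts S T) u \<in> states (search_pts S T) \<and>
      target (search_pts S T) u \<in> states (search_pts S T) \<and>
      0 < prob (search_pts S T) u \<and> prob (search_pts S T) u \<le> 1"
    using S subT nonneg by (auto simp: search_pts_def search_states_def is_pts_def)
  moreover have "\<forall>s\<in>states (search_pts S T). (prob (search_pts S T) has_sum 1)
      {u \<in> transitions (search_pts S T). source (search_pts S T) u = s}"
  proof
    fix s assume "s \<in> states (search_pts S T)"
    then consider "s = None" | s' where "s = Some s'" "s' \<in> search_states S T"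
      by (auto simp: search_pts_def)
    then show "(prob (search_pts S T) has_sum 1)
      {u \<in> transitions (search_pts S T). source (search_pts S T) u = s}"
      by cases (use sink main in auto)
  qed
  moreover have "countable (states (search_pts S T))" "initial (search_pts S T) \<in> states (search_pts S T)"
    using finS by (auto simp: search_pts_def search_states_def countable_finite)
  ultimately show ?thesis unfolding is_pts_def by blast
qed

lemma extends_search_pts: "extends_via Some Found S T (search_pts S T)"
  by (auto simp: extends_via_def search_pts_def)

lemma no_violation_foundI:
  fixes S' :: "('s2, 't2, 'a) pts" and S :: "('s, 't, 'a) pts"
  assumes S': "is_pts S'" and ij: "inj_on i (search_states S T)" "inj_on j T"
    and ext: "extends_via i j S T S'"
    and sat: "\<And>w. w \<in> Exec S' \<Longrightarrow> satisfies S' w P"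
  shows "no_violation_found S T P"
proof -
  define f :: "'s2 \<Rightarrow> 's + nat" where
    "f = (\<lambda>s. if s \<in> i ` search_states S T then Inl (inv_into (search_states S T) i s)
        else Inr (to_nat_on (states S') s))"
  define g :: "'t2 \<Rightarrow> 't + nat" where
    "g = (\<lambda>t. if t \<in> j ` T then Inl (inv_into T j t) else Inr (to_nat_on (transitions S') t))"
  have cS: "countable (states S')" and cT: "countable (transitions S')"
    using S' by (auto simp: is_pts_def)
  have fi: "f (i s) = Inl s" if "s \<in> search_states S T" for s using ij that by (simp add: f_def)
  have gj: "g (j t) = Inl t" if "t \<in> T" for t using ij that by (simp add: g_def)
  have injf: "inj_on f (states S')"
  proof (rule inj_onI)
    fix x y assume xy: "x \<in> states S'" "y \<in> states S'" "f x = f y"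
    then have "x \<in> i ` search_states S T \<longleftrightarrow> y \<in> i ` search_states S T" by (simp add: f_def split: if_splits)
    then show "x = y"
      using xy cS by (cases "x \<in> i ` search_states S T") (simp_all add: f_def inv_into_injective)
  qed
  have injg: "inj_on g (transitions S')"
  proof (rule inj_onI)
    fix x y assume xy: "x \<in> transitions S'" "y \<in> transitions S'" "g x = g y"
    then have "x \<in> j ` T \<longleftrightarrow> y \<in> j ` T" by (simp add: g_def split: if_splits)
    then show "x = y"
      using xy cT by (cases "x \<in> j ` T") (simp_all add: g_def inv_into_injective)
  qed
  define g' where "g' = the_inv_into (transitions S') g"
  define f' where "f' = the_inv_into (states S') f"
  have g': "g' (g t) = t" if "t \<in> transitions S'" for t
    using the_inv_into_f_f[OF injg that] by (simp add: g'_def)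
  have f': "f' (f s) = s" if "s \<in> states S'" for s
    using the_inv_into_f_f[OF injf that] by (simp add: f'_def)
  define R :: "('s + nat, 't + nat, 'a) pts" where
    "R = \<lparr> states = f ` states S', transitions = g ` transitions S', initial = f (initial S'),
       source = (\<lambda>t. f (source S' (g' t))), target = (\<lambda>t. f (target S' (g' t))),
       prob = (\<lambda>t. prob S' (g' t)), label = (\<lambda>s. label S' (f' s)) \<rparr>"
  have st: "source S' t \<in> states S'" "target S' t \<in> states S'" if "t \<in> transitions S'" for t
    using S' that by (auto simp: is_pts_def)
  have ini: "initial S' \<in> states S'" using S' by (simp add: is_pts_def)
  have "is_pts R"
  proof -
    have "(prob R has_sum 1) {t \<in> transitions R. source R t = s}" if sR: "s \<in> states R" for s
    proof -
      obtain s' where s': "s' \<in> states S'" "s = f s'" using sR by (auto simp: R_def)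
      let ?A = "{t \<in> transitions S'. source S' t = s'}"
      have eq: "{t \<in> transitions R. source R t = s} = g ` ?A"
      proof (intro set_eqI iffI)
        fix u assume "u \<in> {t \<in> transitions R. source R t = s}"
        then obtain t where t: "t \<in> transitions S'" "u = g t" "f (source S' t) = f s'"
          using s' g' by (auto simp: R_def)
        then have "source S' t = s'" using inj_onD[OF injf] st s' by blast
        then show "u \<in> g ` ?A" using t by blast
      next
        fix u assume "u \<in> g ` ?A"
        then show "u \<in> {t \<in> transitions R. source R t = s}" using s' g' by (auto simp: R_def)
      qed
      have "inj_on g ?A" using injg by (rule inj_on_subset) auto
      moreover have "((prob R \<circ> g) has_sum 1) ?A \<longleftrightarrow> (prob S' has_sum 1) ?A"
        by (rule has_sum_cong) (simp add: R_def g')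
      moreover have "(prob S' has_sum 1) ?A" using S' s' by (simp add: is_pts_def)
      ultimately show ?thesis unfolding eq by (simp add: has_sum_reindex)
    qed
    then show ?thesis
      using S' cS cT st ini g' by (auto simp: is_pts_def R_def)
  qed
  moreover have "extends_via Inl Inl S T R"
    unfolding extends_via_def
  proof (intro conjI ballI)
    show "initial R = Inl (initial S)" using ext by (simp add: extends_via_def R_def fi search_states_def)
    fix t assume t: "t \<in> T"
    have jt: "j t \<in> transitions S'" and so: "source S' (j t) = i (source S t)"
      and ta: "target S' (j t) = i (target S t)" and pr: "prob S' (j t) = prob S t"
      and ls: "label S' (i (source S t)) = label S (source S t)"
      and lt: "label S' (i (target S t)) = label S (target S t)"
      using ext t by (auto simp: extends_via_def)
    have fst_eq: "f (i (source S t)) = Inl (source S t)" "f (i (target S t)) = Inl (target S t)"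
      using t by (auto intro!: fi simp: search_states_def)
    have gt: "g' (Inl t) = j t" using g'[OF jt] gj[OF t] by simp
    show "Inl t \<in> transitions R" using jt gj[OF t] by (auto simp: R_def intro: rev_image_eqI)
    show "source R (Inl t) = Inl (source S t)" "target R (Inl t) = Inl (target S t)"
      "prob R (Inl t) = prob S t"
      by (simp_all add: R_def gt so ta pr fst_eq)
    have "f' (Inl (source S t)) = i (source S t)" "f' (Inl (target S t)) = i (target S t)"
      using f'[of "i (source S t)"] f'[of "i (target S t)"] st[OF jt] by (simp_all add: so ta fst_eq)
    then show "label R (Inl (source S t)) = label S (source S t)"
      "label R (Inl (target S t)) = label S (target S t)"
      by (simp_all add: R_def ls lt)
  qed
  moreover have "satisfies R w P" if w: "w \<in> Exec R" for w
  proof -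
    have tr: "w !! n \<in> g ` transitions S'" for n
      using w snth_sset[of w n] by (auto simp: Exec_def R_def)
    then have tr': "g' (w !! n) \<in> transitions S'" for n
      using g' by (metis imageE)
    have "smap g' w \<in> Exec S'"
      unfolding Exec_def
    proof (intro CollectI conjI allI)
      show "sset (smap g' w) \<subseteq> transitions S'" using tr' by (auto simp: sset_range)
      have "f (source S' (g' (w !! 0))) = f (initial S')" using w by (simp add: Exec_def R_def)
      then show "source S' (shd (smap g' w)) = initial S'"
        using injf st[OF tr'[of 0]] ini by (auto simp: inj_on_eq_iff)
      fix n
      have "f (target S' (g' (w !! n))) = f (source S' (g' (w !! Suc n)))"
        using w by (simp add: Exec_def R_def)
      then show "target S' (smap g' w !! n) = source S' (smap g' w !! Suc n)"
        using injf st(2)[OF tr'[of n]] st(1)[OF tr'[of "Suc n"]] by (auto simp: inj_on_eq_iff)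
    qed
    moreover have "path_trace R w = path_trace S' (smap g' w)"
      using st(1)[OF tr'] f'
      by (simp add: path_trace_def stream.map_comp)
        (auto intro!: stream.map_cong0 simp: R_def sset_range)
    ultimately show ?thesis using sat by (auto simp: satisfies_def)
  qed
  ultimately show ?thesis unfolding no_violation_found_def by blast
qed

lemma path_measure_exists:
  fixes S :: "('s, 't, 'a) pts"
  assumes S: "is_pts S"
  obtains N where "space N = Exec S" "sets N = sets (path_measure S)" "prob_space N"
    "\<And>e. e \<in> finite_prefixes S \<Longrightarrow> emeasure N (cyl S e) = ennreal (\<Prod>t\<leftarrow>e. prob S t)"
proof -
  define succ where "succ s = {t \<in> transitions S. source S t = s}" for s
  define K :: "nat \<times> 's \<Rightarrow> 't measure" where "K = (\<lambda>(n, s). if s \<in> states S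
    then density (count_space (succ s)) (\<lambda>t. ennreal (prob S t))
    else measure_pmf (return_pmf undefined))"
  have K: "space (K (n, s)) = succ s" "sets (K (n, s)) = Pow (succ s)" if "s \<in> states S" for n s
    using that by (auto simp: K_def)
  have Kprob: "prob_space (K x)" for x
  proof -
    obtain n s where x: "x = (n, s)" by force
    show ?thesis
    proof (cases "s \<in> states S")
      case True
      have hs: "(prob S has_sum 1) (succ s)" using S True by (simp add: is_pts_def succ_def)
      have pos: "0 \<le> prob S t" if "t \<in> succ s" for t
        using S that by (force simp: is_pts_def succ_def)
      have abs: "Infinite_Set_Sum.abs_summable_on (prob S) (succ s)"
        using hs pos by (metis (no_types, lifting) abs_summable_equivalent has_sum_imp_summable real_norm_def abs_of_nonneg summable_on_cong)
      have "(\<integral>\<^sup>+ t. ennreal (prob S t) \<partial>count_space (succ s)) = ennreal (infsetsum (prob S) (succ s))"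
        using abs pos by (rule nn_integral_conv_infsetsum)
      also have "infsetsum (prob S) (succ s) = 1"
        using infsetsum_infsum[OF abs] infsumI[OF hs] by simp
      also have "(\<integral>\<^sup>+ t. ennreal (prob S t) \<partial>count_space (succ s)) =
          (\<integral>\<^sup>+ t. ennreal (prob S t) * indicator (succ s) t \<partial>count_space (succ s))"
        by (rule nn_integral_cong) simp
      finally have "emeasure (K x) (space (K x)) = 1"
        using True by (simp add: x K_def emeasure_density)
      then show ?thesis by (rule prob_spaceI)
    qed (simp add: x K_def measure_pmf.prob_space_axioms)
  qed
  interpret K: product_prob_space K "UNIV \<times> states S"
    using Kprob by (intro product_prob_spaceI)
  have Ksing: "emeasure (K (n, source S t)) {t} = ennreal (prob S t)" if "t \<in> transitions S" for n t
    using that S by (auto simp: K_def is_pts_def emeasure_density succ_def nn_integral_indicator_singleton')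
  define P where "P = Pi\<^sub>M (UNIV \<times> states S) K"
  define st where "st \<omega> = rec_nat (initial S) (\<lambda>n s. target S (\<omega> (n, s)))" for \<omega> :: "nat \<times> 's \<Rightarrow> 't"
  have st0: "st \<omega> 0 = initial S" and stS: "st \<omega> (Suc n) = target S (\<omega> (n, st \<omega> n))" for \<omega> n
    by (simp_all add: st_def)
  define W where "W \<omega> = smap (\<lambda>n. \<omega> (n, st \<omega> n)) nats" for \<omega>
  have Wn: "W \<omega> !! n = \<omega> (n, st \<omega> n)" for \<omega> n by (simp add: W_def)
  have Pin: "\<omega> (n, s) \<in> succ s" if "\<omega> \<in> space P" "s \<in> states S" for \<omega> n s
    using that K[of s n] by (auto simp: P_def space_PiM PiE_def Pi_def)
  have st_in: "st \<omega> n \<in> states S" if \<omega>: "\<omega> \<in> space P" for \<omega> n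
  proof (induction n)
    case 0
    then show ?case using S by (simp add: st0 is_pts_def)
  next
    case (Suc n)
    then show ?case using Pin[OF \<omega> Suc, of n] S by (simp add: stS succ_def is_pts_def)
  qed
  have src: "\<omega> (n, st \<omega> n) \<in> transitions S" "source S (\<omega> (n, st \<omega> n)) = st \<omega> n"
    if \<omega>: "\<omega> \<in> space P" for \<omega> n
    using Pin[OF \<omega> st_in[OF \<omega>], of n n] by (auto simp: succ_def)
  have WE: "W \<omega> \<in> Exec S" if \<omega>: "\<omega> \<in> space P" for \<omega>
    unfolding Exec_def
  proof (intro CollectI conjI allI)
    show "sset (W \<omega>) \<subseteq> transitions S" using src[OF \<omega>] by (auto simp: sset_range Wn)
    show "source S (shd (W \<omega>)) = initial S" using src[OF \<omega>, of 0] Wn[of \<omega> 0] by (simp add: st0)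
    show "target S (W \<omega> !! n) = source S (W \<omega> !! Suc n)" for n
      using src[OF \<omega>, of "Suc n"] by (simp only: Wn stS)
  qed
  have gen: "cyl S ` finite_prefixes S \<subseteq> Pow (Exec S)" by (auto simp: cyl_def)
  have sp: "space (path_measure S) = Exec S"
    and se: "sets (path_measure S) = sigma_sets (Exec S) (cyl S ` finite_prefixes S)"
    unfolding path_measure_def using gen
    by (simp_all add: space_extend_measure sets_extend_measure)
  have main: "W -` cyl S e \<inter> space P \<in> sets P \<and>
      emeasure P (W -` cyl S e \<inter> space P) = ennreal (\<Prod>t\<leftarrow>e. prob S t)"
    if e: "e \<in> finite_prefixes S" for e
  proof -
    obtain n w where w: "w \<in> Exec S" and ew: "e = stake n w" using e by (auto simp: finite_prefixes_def)
    have wt: "w !! k \<in> transitions S" for k using w snth_sset[of w k] by (auto simp: Exec_def)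
    have wS: "source S (w !! k) \<in> states S" for k using wt S by (auto simp: is_pts_def)
    define J where "J = (\<lambda>k. (k, source S (w !! k))) ` {..<n}"
    define X where "X = (\<lambda>(k::nat, s::'s). {w !! k})"
    have J: "J \<subseteq> UNIV \<times> states S" "finite J" using wS by (auto simp: J_def)
    have X: "X x \<in> sets (K x)" if "x \<in> J" for x
      using that wt wS by (auto simp: J_def X_def K succ_def)
    have "W -` cyl S e \<inter> space P = K.emb (UNIV \<times> states S) J (Pi\<^sub>E J X)"
    proof (intro set_eqI iffI)
      fix \<omega> assume a: "\<omega> \<in> W -` cyl S e \<inter> space P"
      then have \<omega>: "\<omega> \<in> space P" and "stake n (W \<omega>) = stake n w"
        by (auto simp: cyl_def ew)
      then have eq: "\<omega> (k, st \<omega> k) = w !! k" if "k < n" for k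
        using that stake_nth[of k n "W \<omega>"] stake_nth[of k n w] by (simp add: Wn)
      have "\<omega> (k, source S (w !! k)) = w !! k" if "k < n" for k
        using eq[OF that] src(2)[OF \<omega>, of k] by simp
      then show "\<omega> \<in> K.emb (UNIV \<times> states S) J (Pi\<^sub>E J X)"
        using \<omega> by (auto simp: prod_emb_def P_def space_PiM J_def X_def restrict_def PiE_def extensional_def)
    next
      fix \<omega> assume a: "\<omega> \<in> K.emb (UNIV \<times> states S) J (Pi\<^sub>E J X)"
      then have \<omega>: "\<omega> \<in> space P" by (auto simp: prod_emb_def P_def space_PiM)
      have eq: "\<omega> (k, source S (w !! k)) = w !! k" if "k < n" for k
      proof -
        have kJ: "(k, source S (w !! k)) \<in> J" using that by (auto simp: J_def)
        have "restrict \<omega> J \<in> Pi\<^sub>E J X" using a by (simp add: prod_emb_def)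
        from PiE_mem[OF this kJ] show ?thesis using kJ by (simp add: X_def)
      qed
      have "st \<omega> k = source S (w !! k)" if "k < n" for k
        using that
      proof (induction k)
        case 0
        then show ?case using w by (simp add: st0 Exec_def)
      next
        case (Suc k)
        then show ?case using eq[of k] w by (simp add: stS Exec_def)
      qed
      then have "stake n (W \<omega>) = stake n w"
        using eq by (intro nth_equalityI) (auto simp: stake_nth Wn)
      then show "\<omega> \<in> W -` cyl S e \<inter> space P" using \<omega> WE by (auto simp: cyl_def ew)
    qed
    moreover have "K.emb (UNIV \<times> states S) J (Pi\<^sub>E J X) \<in> sets P"
      unfolding P_def using J X by (intro sets_PiM_I) auto
    moreover have "emeasure P (K.emb (UNIV \<times> states S) J (Pi\<^sub>E J X)) = (\<Prod>x\<in>J. emeasure (K x) (X x))"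
      unfolding P_def using J X by (rule K.emeasure_PiM_emb)
    moreover have "(\<Prod>x\<in>J. emeasure (K x) (X x)) = (\<Prod>k<n. ennreal (prob S (w !! k)))"
      unfolding J_def by (subst prod.reindex) (auto simp: inj_on_def X_def Ksing wt)
    moreover have "\<dots> = ennreal (\<Prod>k<n. prob S (w !! k))"
      using wt S by (intro prod_ennreal) (simp add: is_pts_def less_imp_le)
    moreover have "(\<Prod>k<n. prob S (w !! k)) = (\<Prod>t\<leftarrow>e. prob S t)"
      unfolding ew by (induction n) (simp_all add: stake_Suc lessThan_Suc mult.commute del: stake.simps(2))
    ultimately show ?thesis by simp
  qed
  have meas: "W \<in> measurable P (path_measure S)"
    by (rule measurable_sigma_sets[OF se gen]) (use WE main in auto)
  interpret P: prob_space P unfolding P_def by (rule K.prob_space_axioms)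
  show thesis
  proof (rule that[of "distr P (path_measure S) W"])
    show "space (distr P (path_measure S) W) = Exec S" using sp by simp
    show "prob_space (distr P (path_measure S) W)" using meas by (rule P.prob_space_distr)
    fix e assume e: "e \<in> finite_prefixes S"
    have "cyl S e \<in> sets (path_measure S)" using e by (auto simp: se)
    then show "emeasure (distr P (path_measure S) W) (cyl S e) = ennreal (\<Prod>t\<leftarrow>e. prob S t)"
      using main[OF e] meas by (simp add: emeasure_distr)
  qed simp
qed

lemma space_path_measure: "space (path_measure S) = Exec S"
  and sets_path_measure: "sets (path_measure S) = sigma_sets (Exec S) (range (cyl S))"
proof -
  have gen: "cyl S ` finite_prefixes S \<subseteq> Pow (Exec S)" by (auto simp: cyl_def)
  then show "space (path_measure S) = Exec S"
    by (simp add: path_measure_def space_extend_measure)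
  have "cyl S e \<in> insert {} (cyl S ` finite_prefixes S)" for e
  proof (cases "cyl S e = {}")
    case False
    then obtain w where "w \<in> Exec S" "e = stake (length e) w" by (auto simp: cyl_def)
    then have "e \<in> finite_prefixes S" unfolding finite_prefixes_def by blast
    then show ?thesis by blast
  qed simp
  then have "cyl S e \<in> sigma_sets (Exec S) (cyl S ` finite_prefixes S)" for e
    by (metis (no_types, lifting) insertE sigma_sets.Basic sigma_sets.Empty)
  then have "sigma_sets (Exec S) (range (cyl S)) = sigma_sets (Exec S) (cyl S ` finite_prefixes S)"
    by (intro antisym sigma_sets_mono sigma_sets_mono') auto
  with gen show "sets (path_measure S) = sigma_sets (Exec S) (range (cyl S))"
    by (simp add: path_measure_def sets_extend_measure)
qed

lemma emeasure_path_measure_cyl: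
  assumes S: "is_pts S" and e: "e \<in> finite_prefixes S"
  shows "emeasure (path_measure S) (cyl S e) = ennreal (\<Prod>t\<leftarrow>e. prob S t)"
proof -
  obtain N where N: "space N = Exec S" "sets N = sets (path_measure S)"
    "\<And>e. e \<in> finite_prefixes S \<Longrightarrow> emeasure N (cyl S e) = ennreal (\<Prod>t\<leftarrow>e. prob S t)"
    using path_measure_exists[OF S] by metis
  show ?thesis
  proof (rule emeasure_extend_measure[OF path_measure_def[of S], where \<mu>' = "emeasure N"])
    show "positive (sets (path_measure S)) (emeasure N)" by (rule emeasure_positive[of N, unfolded N(2)])
    show "countably_additive (sets (path_measure S)) (emeasure N)"
      by (rule emeasure_countably_additive[of N, unfolded N(2)])
  qed (use N e in \<open>auto simp: cyl_def\<close>)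
qed

lemma prob_space_path_measure:
  assumes S: "is_pts S"
  shows "prob_space (path_measure S)"
proof -
  obtain N where N: "space N = Exec S" "prob_space N"
    using path_measure_exists[OF S] by metis
  then have "Exec S \<noteq> {}" using prob_space.not_empty by force
  then have "[] \<in> finite_prefixes S" unfolding finite_prefixes_def
    by (metis (mono_tags, lifting) CollectI ex_in_conv stake.simps(1))
  from emeasure_path_measure_cyl[OF S this] show ?thesis
    by (intro prob_spaceI) (simp add: cyl_def space_path_measure)
qed

end

theory Submission
  imports Defs
begin

text \<open>
  The missing part of the system is replaced by an unlabelled sink, and truth of a positive formula
  is monotone in the labels. Hence, if a path that enters the sink satisfies the formula, so does
  every path that shares its transitions before the sink. A path that never enters the sink is also
  a path of the violation-free extension and satisfies the formula; once it visits a state from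
  which the sink is unreachable, all its continuations are of this kind. The remaining paths stay
  forever among the finitely many states from which the sink is reachable without entering it, and
  they form a null set: the limit of the probabilities of staying for \<open>n\<close> steps is a bounded
  harmonic function, which vanishes by the maximum principle.
\<close>

section \<open>Execution paths and cylinders\<close>

lemma Exec_iff_snth:
  "w \<in> Exec S \<longleftrightarrow> (\<forall>n. w !! n \<in> transitions S) \<and> source S (w !! 0) = initial S \<and>
    (\<forall>n. target S (w !! n) = source S (w !! Suc n))"
  by (auto simp: Exec_def sset_range)

lemma Exec_snth_in: "w \<in> Exec S \<Longrightarrow> w !! n \<in> transitions S"
  by (simp add: Exec_iff_snth)

lemma Exec_target_snth: "w \<in> Exec S \<Longrightarrow> target S (w !! n) = source S (w !! Suc n)"
  by (simp only: Exec_iff_snth)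

definition end_state :: "('s, 't, 'a) pts \<Rightarrow> 't list \<Rightarrow> 's" where
  "end_state S e = (if e = [] then initial S else target S (last e))"

lemma mem_cyl_stake_iff:
  "w' \<in> cyl S (stake n w) \<longleftrightarrow> w' \<in> Exec S \<and> (\<forall>k<n. w' !! k = w !! k)"
  by (auto simp: cyl_def list_eq_iff_nth_eq)

lemma source_snth_cyl:
  assumes "w \<in> cyl S e"
  shows "source S (w !! length e) = end_state S e"
proof (cases e rule: rev_cases)
  case Nil
  then show ?thesis using assms by (simp add: cyl_def Exec_iff_snth end_state_def)
next
  case (snoc e' t)
  then have "w !! length e' = t" using assms by (simp add: cyl_def stake_Suc del: stake.simps(2))
  then show ?thesis
    using assms snoc by (auto simp: cyl_def Exec_iff_snth end_state_def simp del: snth.simps)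
qed

lemma source_snth_cyl_stake:
  assumes "w \<in> Exec S" "w' \<in> cyl S (stake n w)" "k \<le> n"
  shows "source S (w' !! k) = source S (w !! k)"
proof -
  have "w \<in> cyl S (stake k w)" "w' \<in> cyl S (stake k w)"
    using assms by (auto simp: mem_cyl_stake_iff)
  then show ?thesis using source_snth_cyl[of _ S "stake k w"] by simp
qed

lemma cyl_streams_subset:
  "cyl S e \<inter> streams G
    \<subseteq> (\<Union>t\<in>{t. t \<in> G \<and> source S t = end_state S e}. cyl S (e @ [t]) \<inter> streams G)"
proof
  fix w assume w: "w \<in> cyl S e \<inter> streams G"
  let ?t = "w !! length e"
  have "?t \<in> G" "source S ?t = end_state S e"
    using w source_snth_cyl[of w S e] by (auto simp: snth_in)
  moreover have "w \<in> cyl S (e @ [?t])"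
    using w by (simp add: cyl_def stake_Suc del: stake.simps(2))
  ultimately show "w \<in> (\<Union>t\<in>{t. t \<in> G \<and> source S t = end_state S e}. cyl S (e @ [t]) \<inter> streams G)"
    using w by blast
qed

lemma cyl_in_sets_path_measure: "cyl S e \<in> sets (path_measure S)"
  by (auto simp: sets_path_measure)

lemma emeasure_cyl_le:
  assumes "is_pts S"
  shows "emeasure (path_measure S) (cyl S e) \<le> ennreal (\<Prod>t\<leftarrow>e. prob S t)"
proof (cases "cyl S e = {}")
  case False
  then obtain w where "w \<in> Exec S" "e = stake (length e) w" by (auto simp: cyl_def)
  then have "e \<in> finite_prefixes S" unfolding finite_prefixes_def by blast
  then show ?thesis using emeasure_path_measure_cyl[OF assms] by simp
qed simp

lemma Exec_streams_in_sets:
  assumes "countable G"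
  shows "Exec S \<inter> streams G \<in> sets (path_measure S)"
proof -
  have "Exec S \<inter> streams G = (\<Inter>n. \<Union>e\<in>{e \<in> lists G. length e = n}. cyl S e)"
  proof (intro set_eqI iffI)
    fix w assume w: "w \<in> Exec S \<inter> streams G"
    have "stake n w \<in> {e \<in> lists G. length e = n}" for n
      using w by (auto simp: in_set_conv_nth snth_in)
    moreover have "w \<in> cyl S (stake n w)" for n
      using w by (simp add: mem_cyl_stake_iff)
    ultimately show "w \<in> (\<Inter>n. \<Union>e\<in>{e \<in> lists G. length e = n}. cyl S e)" by blast
  next
    fix w assume "w \<in> (\<Inter>n. \<Union>e\<in>{e \<in> lists G. length e = n}. cyl S e)"
    then have w: "w \<in> Exec S" "set (stake n w) \<subseteq> G" for n by (auto simp: cyl_def)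
    have "w !! n \<in> G" for n
      using w(2)[of "Suc n"] by (simp add: stake_Suc del: stake.simps(2))
    then show "w \<in> Exec S \<inter> streams G" using w(1) by (simp add: streams_iff_snth)
  qed
  moreover have "countable {e \<in> lists G. length e = n}" for n
    by (rule countable_subset[of _ "lists G"]) (use assms in auto)
  ultimately show ?thesis
    by (auto intro!: sets.countable_INT sets.countable_UN' cyl_in_sets_path_measure)
qed

lemma cyl_streams_in_sets:
  assumes "countable G"
  shows "cyl S e \<inter> streams G \<in> sets (path_measure S)"
proof -
  have within_Exec: "cyl S e \<inter> streams G = cyl S e \<inter> (Exec S \<inter> streams G)"
    by (auto simp: cyl_def)
  show ?thesis
    unfolding within_Exec by (intro sets.Int cyl_in_sets_path_measure Exec_streams_in_sets assms)
qed

lemma emeasure_cyl_streams_le_sum: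
  assumes "finite G"
  shows "emeasure (path_measure S) (cyl S e \<inter> streams G)
    \<le> (\<Sum>t | t \<in> G \<and> source S t = end_state S e.
        emeasure (path_measure S) (cyl S (e @ [t]) \<inter> streams G))"
proof -
  let ?\<mu> = "emeasure (path_measure S)" and ?N = "{t. t \<in> G \<and> source S t = end_state S e}"
  have sets: "cyl S (e @ [t]) \<inter> streams G \<in> sets (path_measure S)" for t
    using assms by (intro cyl_streams_in_sets countable_finite)
  have "?\<mu> (cyl S e \<inter> streams G) \<le> ?\<mu> (\<Union>t\<in>?N. cyl S (e @ [t]) \<inter> streams G)"
    using sets assms by (intro emeasure_mono cyl_streams_subset sets.finite_UN) auto
  also have "\<dots> \<le> (\<Sum>t\<in>?N. ?\<mu> (cyl S (e @ [t]) \<inter> streams G))"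
    using sets assms by (intro emeasure_subadditive_finite) auto
  finally show ?thesis .
qed

lemma good_pathsI:
  assumes "w \<in> Exec S" "\<And>k. k < n \<Longrightarrow> w !! k \<in> T"
    and "\<And>w'. w' \<in> cyl S (stake n w) \<Longrightarrow> satisfies S w' P"
  shows "w \<in> good_paths S T P"
proof -
  have "stake n w \<in> lists T" using assms(2) by (auto simp: in_set_conv_nth)
  moreover have "w \<in> cyl S (stake n w)" using assms(1) by (simp add: mem_cyl_stake_iff)
  ultimately show ?thesis using assms(3) unfolding good_paths_def by blast
qed

lemma good_paths_subset: "good_paths S T P \<subseteq> {w \<in> Exec S. satisfies S w P}"
  by (auto simp: good_paths_def cyl_def)

lemma good_paths_in_sets:
  assumes "countable T"
  shows "good_paths S T P \<in> sets (path_measure S)"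
proof -
  have "countable {cyl S e | e. e \<in> lists T \<and> (\<forall>w\<in>cyl S e. satisfies S w P)}"
    by (rule countable_subset[of _ "cyl S ` lists T"]) (use assms in auto)
  then show ?thesis
    unfolding good_paths_def
    by (intro sets.countable_Union) (auto simp: cyl_in_sets_path_measure)
qed

section \<open>Leaky sets of transitions\<close>

text \<open>
  A state that no transition of \<open>G\<close> leaves is leaky, even if it lies outside \<^term>\<open>states S\<close>: its
  \<^const>\<open>out_prob\<close> is the empty sum.
\<close>

inductive leaky :: "('s, 't, 'a) pts \<Rightarrow> 't set \<Rightarrow> 's \<Rightarrow> bool" for S G where
  now: "out_prob S G s < 1 \<Longrightarrow> leaky S G s"
| step: "t \<in> G \<Longrightarrow> leaky S G (target S t) \<Longrightarrow> leaky S G (source S t)"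

definition leaky_transitions :: "('s, 't, 'a) pts \<Rightarrow> 't set \<Rightarrow> 't set" where
  "leaky_transitions S G = {t \<in> G. leaky S G (source S t)}"

definition expected_next ::
  "('s, 't, 'a) pts \<Rightarrow> 't set \<Rightarrow> ('s \<Rightarrow> real) \<Rightarrow> 's \<Rightarrow> real" where
  "expected_next S G q s = (\<Sum>t | t \<in> G \<and> source S t = s. prob S t * q (target S t))"

definition subharmonic :: "('s, 't, 'a) pts \<Rightarrow> 't set \<Rightarrow> ('s \<Rightarrow> real) \<Rightarrow> bool" where
  "subharmonic S G q \<longleftrightarrow> (\<forall>s. q s \<le> expected_next S G q s)"

primrec stay_prob :: "('s, 't, 'a) pts \<Rightarrow> 't set \<Rightarrow> nat \<Rightarrow> 's \<Rightarrow> real" where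
  "stay_prob S G 0 = (\<lambda>s. 1)"
| "stay_prob S G (Suc n) = expected_next S G (stay_prob S G n)"

lemma expected_next_const: "expected_next S G (\<lambda>_. c) s = out_prob S G s * c"
  by (simp add: expected_next_def out_prob_def sum_distrib_right)

lemma tendsto_expected_next:
  assumes "\<And>s. ((\<lambda>x. q x s) \<longlongrightarrow> r s) F"
  shows "((\<lambda>x. expected_next S G (q x) s) \<longlongrightarrow> expected_next S G r s) F"
  unfolding expected_next_def by (intro tendsto_sum tendsto_mult tendsto_const assms)

lemma prob_pos: "is_pts S \<Longrightarrow> t \<in> transitions S \<Longrightarrow> 0 < prob S t"
  by (simp add: is_pts_def)

lemma out_prob_le_1:
  assumes S: "is_pts S" and G: "is_search S G"
  shows "out_prob S G s \<le> 1"
proof (cases "s \<in> states S")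
  case True
  have "(prob S has_sum out_prob S G s) {t. t \<in> G \<and> source S t = s}"
    unfolding out_prob_def using G by (intro has_sum_finite) (auto simp: is_search_def)
  moreover have "(prob S has_sum 1) {t \<in> transitions S. source S t = s}"
    using S True by (simp add: is_pts_def)
  ultimately show ?thesis
    by (rule has_sum_mono_neutral)
      (use S G in \<open>auto simp: is_search_def intro: less_imp_le[OF prob_pos]\<close>)
next
  case False
  then have no_transition: "{t. t \<in> G \<and> source S t = s} = {}"
    using S G by (auto simp: is_pts_def is_search_def)
  show ?thesis unfolding out_prob_def no_transition by simp
qed

lemma out_prob_mono:
  assumes "is_pts S" "is_search S G" "H \<subseteq> G"
  shows "out_prob S H s \<le> out_prob S G s"
  unfolding out_prob_def
  by (rule sum_mono2) (use assms in \<open>auto simp: is_search_def intro: less_imp_le[OF prob_pos]\<close>)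

lemma transition_in_if_out_prob_ge_1:
  assumes S: "is_pts S" and G: "is_search S G"
    and t: "t \<in> transitions S" and no_leak: "1 \<le> out_prob S G (source S t)"
  shows "t \<in> G"
proof (rule ccontr)
  assume "t \<notin> G"
  have "{u. u \<in> insert t G \<and> source S u = source S t}
      = insert t {u. u \<in> G \<and> source S u = source S t}"
    by auto
  then have "out_prob S (insert t G) (source S t) = prob S t + out_prob S G (source S t)"
    using G \<open>t \<notin> G\<close> by (simp add: out_prob_def is_search_def)
  moreover have "out_prob S (insert t G) (source S t) \<le> 1"
    using G t by (intro out_prob_le_1[OF S]) (simp add: is_search_def)
  ultimately show False using prob_pos[OF S t] no_leak by simp
qed

lemma leaky_leaky_transitions:
  assumes S: "is_pts S" and G: "is_search S G"
  shows "leaky S (leaky_transitions S G) s"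
proof (cases "leaky S G s")
  case True
  then show ?thesis
  proof induction
    case (now s)
    have "out_prob S (leaky_transitions S G) s \<le> out_prob S G s"
      by (intro out_prob_mono[OF S G]) (auto simp: leaky_transitions_def)
    then show ?case using now by (intro leaky.now) simp
  next
    case (step t)
    then have "t \<in> leaky_transitions S G" by (simp add: leaky_transitions_def leaky.step)
    then show ?case using step.IH by (rule leaky.step)
  qed
next
  case False
  then have no_transition: "{t. t \<in> leaky_transitions S G \<and> source S t = s} = {}"
    by (auto simp: leaky_transitions_def)
  have "out_prob S (leaky_transitions S G) s = 0" unfolding out_prob_def no_transition by simp
  then show ?thesis by (intro leaky.now) simp
qed

context
  fixes S :: "('s, 't, 'a) pts" and G :: "'t set"
  assumes pts: "is_pts S" and search: "is_search S G"
begin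

lemma search_prob_pos: "t \<in> G \<Longrightarrow> 0 < prob S t"
  using search by (intro prob_pos[OF pts]) (auto simp: is_search_def)

lemma expected_next_mono:
  assumes "\<And>t. t \<in> G \<Longrightarrow> q (target S t) \<le> r (target S t)"
  shows "expected_next S G q s \<le> expected_next S G r s"
  unfolding expected_next_def using assms
  by (intro sum_mono mult_left_mono) (auto intro: less_imp_le[OF search_prob_pos])

lemma expected_next_strict_mono:
  assumes target_le: "\<And>t. t \<in> G \<Longrightarrow> q (target S t) \<le> r (target S t)"
    and target_less: "t \<in> G" "q (target S t) < r (target S t)"
  shows "expected_next S G q (source S t) < expected_next S G r (source S t)"
  unfolding expected_next_def
proof (rule sum_strict_mono_ex1)
  show "\<forall>u\<in>{u. u \<in> G \<and> source S u = source S t}.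
      prob S u * q (target S u) \<le> prob S u * r (target S u)"
    using target_le by (auto intro!: mult_left_mono intro: less_imp_le[OF search_prob_pos])
  show "\<exists>u\<in>{u. u \<in> G \<and> source S u = source S t}.
      prob S u * q (target S u) < prob S u * r (target S u)"
    using target_less search_prob_pos by (intro bexI[of _ t]) auto
qed (use search in \<open>simp add: is_search_def\<close>)

lemma stay_prob_nonneg: "0 \<le> stay_prob S G n s"
proof (induction n arbitrary: s)
  case (Suc n)
  have "0 = expected_next S G (\<lambda>_. 0) s" by (simp add: expected_next_const)
  also have "\<dots> \<le> stay_prob S G (Suc n) s" using Suc by (auto intro: expected_next_mono)
  finally show ?case .
qed simp

lemma stay_prob_Suc_le: "stay_prob S G (Suc n) s \<le> stay_prob S G n s"
proof (induction n arbitrary: s)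
  case 0
  then show ?case using out_prob_le_1[OF pts search] by (simp add: expected_next_const)
next
  case (Suc n)
  have "expected_next S G (stay_prob S G (Suc n)) s \<le> expected_next S G (stay_prob S G n) s"
    by (intro expected_next_mono Suc)
  then show ?case by simp
qed

lemma subharmonic_less_at_leaky:
  assumes q: "subharmonic S G q"
    and "0 < m" and target_le: "\<And>t. t \<in> G \<Longrightarrow> q (target S t) \<le> m"
    and "leaky S G s"
  shows "q s < m"
  using \<open>leaky S G s\<close>
proof induction
  case (now s)
  have "q s \<le> expected_next S G q s"
    using q by (simp add: subharmonic_def)
  also have "\<dots> \<le> expected_next S G (\<lambda>_. m) s" using target_le by (rule expected_next_mono)
  also have "\<dots> < m" using now \<open>0 < m\<close> by (simp add: expected_next_const)
  finally show ?case .
next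
  case (step t)
  have "q (source S t) \<le> expected_next S G q (source S t)"
    using q by (simp add: subharmonic_def)
  also have "\<dots> < expected_next S G (\<lambda>_. m) (source S t)"
    using target_le step.hyps(1) step.IH by (rule expected_next_strict_mono)
  also have "\<dots> \<le> m"
    using out_prob_le_1[OF pts search] \<open>0 < m\<close> by (simp add: expected_next_const)
  finally show ?case .
qed

lemma subharmonic_nonpos:
  assumes leaky: "\<And>s. leaky S G s"
    and q: "subharmonic S G q"
  shows "q s \<le> 0"
proof (rule ccontr)
  define X where "X = insert s (target S ` G)"
  define m where "m = Max (q ` X)"
  assume "\<not> q s \<le> 0"
  have finite_X: "finite X" and s_in_X: "s \<in> X" using search by (auto simp: X_def is_search_def)
  then have le_m: "q x \<le> m" if "x \<in> X" for x using that finite_X by (simp add: m_def)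
  then have "0 < m" using \<open>\<not> q s \<le> 0\<close> s_in_X by force
  moreover have "q (target S t) \<le> m" if "t \<in> G" for t using that by (simp add: le_m X_def)
  ultimately have "q x < m" for x using q leaky by (metis subharmonic_less_at_leaky)
  moreover have "m \<in> q ` X" unfolding m_def using finite_X s_in_X by (intro Max_in) auto
  ultimately show False by auto
qed

lemma stay_prob_tendsto_0:
  assumes leaky: "\<And>s. leaky S G s"
  shows "(\<lambda>n. stay_prob S G n s) \<longlonglongrightarrow> 0"
proof -
  have "convergent (\<lambda>n. stay_prob S G n s)" for s
    using decseq_convergent[OF decseq_SucI[of "\<lambda>n. stay_prob S G n s", OF stay_prob_Suc_le]]
      stay_prob_nonneg
    by (metis convergentI)
  then obtain q where q: "\<And>s. (\<lambda>n. stay_prob S G n s) \<longlonglongrightarrow> q s"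
    unfolding convergent_def by metis
  have "q s = expected_next S G q s" for s
  proof (rule LIMSEQ_unique)
    show "(\<lambda>n. stay_prob S G (Suc n) s) \<longlonglongrightarrow> q s" using q by (rule LIMSEQ_Suc)
    show "(\<lambda>n. stay_prob S G (Suc n) s) \<longlonglongrightarrow> expected_next S G q s"
      using tendsto_expected_next[OF q] by simp
  qed
  then have "subharmonic S G q" by (simp add: subharmonic_def)
  then have "q s \<le> 0" using leaky by (intro subharmonic_nonpos)
  moreover have "0 \<le> q s"
    using q by (rule LIMSEQ_le_const) (use stay_prob_nonneg in auto)
  ultimately show ?thesis using q[of s] by simp
qed

lemma emeasure_cyl_streams_le:
  assumes "set e \<subseteq> G"
  shows "emeasure (path_measure S) (cyl S e \<inter> streams G)
    \<le> ennreal ((\<Prod>t\<leftarrow>e. prob S t) * stay_prob S G n (end_state S e))"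
  using assms
proof (induction n arbitrary: e)
  case 0
  have "emeasure (path_measure S) (cyl S e \<inter> streams G) \<le> emeasure (path_measure S) (cyl S e)"
    by (intro emeasure_mono cyl_in_sets_path_measure) simp
  also have "\<dots> \<le> ennreal (\<Prod>t\<leftarrow>e. prob S t)" by (rule emeasure_cyl_le[OF pts])
  finally show ?case by simp
next
  case (Suc n)
  let ?\<mu> = "emeasure (path_measure S)" and ?p = "\<Prod>t\<leftarrow>e. prob S t"
  let ?N = "{t. t \<in> G \<and> source S t = end_state S e}"
  have "?\<mu> (cyl S e \<inter> streams G) \<le> (\<Sum>t\<in>?N. ?\<mu> (cyl S (e @ [t]) \<inter> streams G))"
    using search by (intro emeasure_cyl_streams_le_sum) (simp add: is_search_def)
  also have "\<dots> \<le> (\<Sum>t\<in>?N. ennreal (?p * (prob S t * stay_prob S G n (target S t))))"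
  proof (rule sum_mono)
    fix t assume "t \<in> ?N"
    then show "?\<mu> (cyl S (e @ [t]) \<inter> streams G)
        \<le> ennreal (?p * (prob S t * stay_prob S G n (target S t)))"
      using Suc.IH[of "e @ [t]"] Suc.prems by (simp add: end_state_def mult.assoc)
  qed
  also have "\<dots> = ennreal (\<Sum>t\<in>?N. ?p * (prob S t * stay_prob S G n (target S t)))"
    using Suc.prems
    by (intro sum_ennreal mult_nonneg_nonneg prod_list_nonneg stay_prob_nonneg)
      (auto intro: less_imp_le[OF search_prob_pos])
  also have "\<dots> = ennreal (?p * stay_prob S G (Suc n) (end_state S e))"
    by (simp add: expected_next_def sum_distrib_left)
  finally show ?case .
qed

lemma Exec_streams_null:
  assumes "\<And>s. leaky S G s"
  shows "Exec S \<inter> streams G \<in> null_sets (path_measure S)"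
proof -
  let ?\<mu> = "emeasure (path_measure S)"
  have bound: "?\<mu> (Exec S \<inter> streams G) \<le> ennreal (stay_prob S G n (initial S))" for n
    using emeasure_cyl_streams_le[of "[]" n] by (simp add: cyl_def end_state_def)
  have "(\<lambda>n. ennreal (stay_prob S G n (initial S))) \<longlonglongrightarrow> ennreal 0"
    using stay_prob_tendsto_0[OF assms] by (rule tendsto_ennrealI)
  then have "?\<mu> (Exec S \<inter> streams G) \<le> ennreal 0"
    by (rule LIMSEQ_le_const) (use bound in blast)
  then show ?thesis
    using search
    by (auto simp: null_sets_def is_search_def intro!: Exec_streams_in_sets countable_finite)
qed

lemma Exec_snth_in_if_not_leaky:
  assumes w: "w \<in> Exec S" and n: "\<not> leaky S G (source S (w !! n))" and "n \<le> k"
  shows "w !! k \<in> G"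
proof -
  have in_G: "w !! k \<in> G" if "\<not> leaky S G (source S (w !! k))" for k
  proof (rule transition_in_if_out_prob_ge_1[OF pts search])
    show "w !! k \<in> transitions S" using w by (rule Exec_snth_in)
    show "1 \<le> out_prob S G (source S (w !! k))" using that leaky.now by (metis not_le)
  qed
  have "\<not> leaky S G (source S (w !! k))" using \<open>n \<le> k\<close>
  proof (induction k rule: dec_induct)
    case (step k)
    have "\<not> leaky S G (target S (w !! k))" using step.IH in_G leaky.step by metis
    then show ?case by (simp only: Exec_target_snth[OF w] not_False_eq_True)
  qed (rule n)
  then show ?thesis by (rule in_G)
qed

lemma Exec_streams_subset_good_paths_Un_leaky:
  assumes sat: "\<And>w. w \<in> Exec S \<Longrightarrow> w \<in> streams G \<Longrightarrow> satisfies S w P"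
  shows "Exec S \<inter> streams G \<subseteq> good_paths S G P \<union> streams (leaky_transitions S G)"
proof
  fix w assume "w \<in> Exec S \<inter> streams G"
  then have w: "w \<in> Exec S" "\<And>n. w !! n \<in> G" by (auto simp: snth_in)
  consider (leaky) "w \<in> streams (leaky_transitions S G)"
    | (tight) n where "\<not> leaky S G (source S (w !! n))"
    using w(2) by (auto simp: streams_iff_snth leaky_transitions_def)
  then show "w \<in> good_paths S G P \<union> streams (leaky_transitions S G)"
  proof cases
    case tight
    have "w \<in> good_paths S G P"
    proof (rule good_pathsI[OF w])
      fix w' assume w': "w' \<in> cyl S (stake n w)"
      then have exec: "w' \<in> Exec S" by (simp add: cyl_def)
      have "\<not> leaky S G (source S (w' !! n))"
        using tight source_snth_cyl_stake[OF w(1) w'] by simp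
      then have "w' !! k \<in> G" for k
        using w' w(2) Exec_snth_in_if_not_leaky[OF exec]
        by (cases "k < n") (auto simp: mem_cyl_stake_iff)
      then show "satisfies S w' P" using exec by (intro sat) (auto simp: streams_iff_snth)
    qed
    then show ?thesis by simp
  qed simp
qed

end

section \<open>Extensions of a search\<close>

lemma smap_in_Exec_iff:
  assumes ext: "extends_via i j S T S'" and inj: "inj_on i (search_states S T)"
    and T: "T \<subseteq> transitions S" and w: "w \<in> streams T"
  shows "smap j w \<in> Exec S' \<longleftrightarrow> w \<in> Exec S"
proof -
  have in_T: "w !! n \<in> T" for n using w by (rule snth_in)
  have "w !! n \<in> transitions S" "smap j w !! n \<in> transitions S'"
    "source S' (smap j w !! n) = i (source S (w !! n))"
    "target S' (smap j w !! n) = i (target S (w !! n))" for n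
    using in_T ext T by (auto simp: extends_via_def)
  moreover have "initial S' = i (initial S)" using ext by (simp add: extends_via_def)
  moreover have "source S (w !! n) \<in> search_states S T" "target S (w !! n) \<in> search_states S T"
    "initial S \<in> search_states S T" for n
    using in_T by (auto simp: search_states_def)
  ultimately show ?thesis by (simp only: Exec_iff_snth inj_on_eq_iff[OF inj] simp_thms)
qed

lemma path_trace_smap:
  assumes "extends_via i j S T S'" "w \<in> streams T"
  shows "path_trace S' (smap j w) = path_trace S w"
  unfolding path_trace_def stream.map_comp
  using assms by (intro stream.map_cong0) (auto simp: extends_via_def streams_iff_sset subset_iff)

lemma no_violation_found_satisfies:
  fixes S :: "('s, 't, 'a) pts" and S' :: "('s2, 't2, 'a) pts"
  assumes no_violation: "no_violation_found S T P" and T: "T \<subseteq> transitions S"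
    and ext: "extends_via i j S T S'" and inj: "inj_on i (search_states S T)"
    and w: "w \<in> Exec S'" "w \<in> streams (j ` T)"
  shows "satisfies S' w P"
proof -
  obtain R :: "('s + nat, 't + nat, 'a) pts"
    where R: "extends_via Inl Inl S T R" "\<And>w. w \<in> Exec R \<Longrightarrow> satisfies R w P"
    using no_violation by (auto simp: no_violation_found_def)
  define v where "v = smap (inv_into T j) w"
  have v: "v \<in> streams T" "smap j v = w"
    using w(2)
    by (auto simp: v_def streams_iff_snth smap_alt inv_into_into f_inv_into_f simp del: image_iff)
  have "v \<in> Exec S" using w(1) v(2) smap_in_Exec_iff[OF ext inj T v(1)] by simp
  then have "smap Inl v \<in> Exec R" using smap_in_Exec_iff[OF R(1) _ T v(1)] by simp
  then have "satisfies R (smap Inl v) P" by (rule R(2))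
  then show ?thesis
    using path_trace_smap[OF R(1) v(1)] path_trace_smap[OF ext v(1)] v(2)
    by (simp add: satisfies_def)
qed

lemma is_search_search_pts:
  assumes "is_search S T"
  shows "is_search (search_pts S T) (Found ` T)"
  using assms by (auto simp: is_search_def search_pts_def)

lemma source_search_pts_sink:
  assumes w: "w \<in> Exec (search_pts S T)" and n: "w !! n \<notin> Found ` T" and "n < k"
  shows "source (search_pts S T) (w !! k) = None"
  using \<open>n < k\<close>[THEN Suc_leI]
proof (induction k rule: dec_induct)
  case base
  have "target (search_pts S T) (w !! n) = None"
    using Exec_snth_in[OF w, of n] n by (auto simp: search_pts_def)
  then show ?case by (simp only: Exec_target_snth[OF w])
next
  case (step k)
  have "w !! k \<in> transitions (search_pts S T)" using w by (rule Exec_snth_in)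
  then have "w !! k = Sink_Loop" using step.IH by (auto simp: search_pts_def)
  then have "target (search_pts S T) (w !! k) = None" by (simp add: search_pts_def)
  then show ?case by (simp only: Exec_target_snth[OF w])
qed

section \<open>Positive formulas\<close>

definition upward_closed :: "'a set stream set \<Rightarrow> bool" where
  "upward_closed P \<longleftrightarrow> (\<forall>x\<in>P. \<forall>y. (\<forall>n. x !! n \<subseteq> y !! n) \<longrightarrow> y \<in> P)"

lemma ltl_sat_mono:
  assumes "ltl_sat f x" "\<And>n. x !! n \<subseteq> y !! n"
  shows "ltl_sat f y"
  using assms
proof (induction f arbitrary: x y)
  case (LAtom a)
  then show ?case using LAtom.prems(2)[of 0] by auto
next
  case (LAnd f g)
  then show ?case by (metis ltl_sat.simps(4))
next
  case (LOr f g)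
  then show ?case by (metis ltl_sat.simps(5))
next
  case (LNext f)
  have "stl x !! n \<subseteq> stl y !! n" for n using LNext.prems(2)[of "Suc n"] by simp
  then show ?case using LNext.IH[of "stl x" "stl y"] LNext.prems(1) by simp
next
  case (LUntil f g)
  have "sdrop k x !! n \<subseteq> sdrop k y !! n" for k n
    using LUntil.prems(2) by (simp add: sdrop_snth)
  then have "ltl_sat f (sdrop k x) \<Longrightarrow> ltl_sat f (sdrop k y)"
    "ltl_sat g (sdrop k x) \<Longrightarrow> ltl_sat g (sdrop k y)" for k
    using LUntil.IH[of "sdrop k x" "sdrop k y"] by auto
  then show ?case using LUntil.prems(1) unfolding ltl_sat.simps by metis
next
  case (LRelease f g)
  have "sdrop k x !! n \<subseteq> sdrop k y !! n" for k n
    using LRelease.prems(2) by (simp add: sdrop_snth)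
  then have "ltl_sat f (sdrop k x) \<Longrightarrow> ltl_sat f (sdrop k y)"
    "ltl_sat g (sdrop k x) \<Longrightarrow> ltl_sat g (sdrop k y)" for k
    using LRelease.IH[of "sdrop k x" "sdrop k y"] by auto
  then show ?case using LRelease.prems(1) unfolding ltl_sat.simps by metis
qed simp_all

lemma upward_closed_models: "upward_closed (models f)"
  unfolding upward_closed_def models_def using ltl_sat_mono by blast

lemma sink_exec_in_good_paths:
  assumes "upward_closed P" and w: "w \<in> Exec (search_pts S T)" "satisfies (search_pts S T) w P"
    and sink: "w \<notin> streams (Found ` T)"
  shows "w \<in> good_paths (search_pts S T) (Found ` T) P"
proof -
  let ?M = "search_pts S T"
  define n where "n = (LEAST n. w !! n \<notin> Found ` T)"
  have n: "w !! n \<notin> Found ` T"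
    unfolding n_def by (rule LeastI_ex) (use sink in \<open>simp add: streams_iff_snth\<close>)
  show ?thesis
  proof (rule good_pathsI[OF w(1), of n])
    show "w !! k \<in> Found ` T" if "k < n" for k using not_less_Least that unfolding n_def by blast
    fix w' assume w': "w' \<in> cyl ?M (stake n w)"
    have "path_trace ?M w !! k \<subseteq> path_trace ?M w' !! k" for k
    proof (cases "k \<le> n")
      case True
      then show ?thesis using source_snth_cyl_stake[OF w(1) w'] by (simp add: path_trace_def)
    next
      case False
      then have "label ?M (source ?M (w !! k)) = {}"
        using source_search_pts_sink[OF w(1) n] by (simp add: search_pts_def)
      then show ?thesis by (simp add: path_trace_def)
    qed
    then show "satisfies ?M w' P"
      using \<open>upward_closed P\<close> w(2) by (auto simp: upward_closed_def satisfies_def)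
  qed
qed

lemma satisfying_Exec_search_pts_eq:
  assumes S: "is_pts S" and T: "is_search S T"
    and P: "upward_closed P" "no_violation_found S T P"
  shows "{w \<in> Exec (search_pts S T). satisfies (search_pts S T) w P}
    = good_paths (search_pts S T) (Found ` T) P
      \<union> (Exec (search_pts S T) \<inter> streams (leaky_transitions (search_pts S T) (Found ` T)))"
    (is "?Sat = ?Good \<union> (?E \<inter> streams ?L)")
proof (intro antisym Un_least good_paths_subset)
  have sat: "satisfies (search_pts S T) w P" if "w \<in> ?E" "w \<in> streams (Found ` T)" for w
    using T that
    by (intro no_violation_found_satisfies[OF P(2) _ extends_search_pts]) (auto simp: is_search_def)
  show "?Sat \<subseteq> ?Good \<union> (?E \<inter> streams ?L)"
    using sink_exec_in_good_paths[OF P(1)] Exec_streams_subset_good_paths_Un_leaky[OF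
        is_pts_search_pts[OF S T] is_search_search_pts[OF T] sat]
    by blast
  have "streams ?L \<subseteq> streams (Found ` T)"
    by (rule streams_mono2) (auto simp: leaky_transitions_def)
  then show "?E \<inter> streams ?L \<subseteq> ?Sat" using sat by blast
qed

theorem theorem3:
  fixes S :: "('s, 't, 'a) pts" and T :: "'t set" and \<phi> :: "'a ltl_pos"
  assumes "is_pts S"
    and "is_search S T"
    and "no_violation_found S T (models \<phi>)"
  shows "emeasure (path_measure (search_pts S T))
           (good_paths (search_pts S T) (Found ` T) (models \<phi>))
       = emeasure (path_measure (search_pts S T))
           {e \<in> Exec (search_pts S T). satisfies (search_pts S T) e (models \<phi>)}"
proof -
  let ?M = "search_pts S T"
  let ?L = "leaky_transitions ?M (Found ` T)"
  have M: "is_pts ?M" "is_search ?M (Found ` T)"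
    using assms(1,2) by (auto intro: is_pts_search_pts is_search_search_pts)
  then have "is_search ?M ?L" by (auto simp: is_search_def leaky_transitions_def)
  then have "Exec ?M \<inter> streams ?L \<in> null_sets (path_measure ?M)"
    using M by (intro Exec_streams_null leaky_leaky_transitions)
  moreover have "good_paths ?M (Found ` T) (models \<phi>) \<in> sets (path_measure ?M)"
    using assms(2) by (intro good_paths_in_sets) (simp add: is_search_def countable_finite)
  ultimately show ?thesis
    by (simp only: satisfying_Exec_search_pts_eq[OF assms(1,2) upward_closed_models assms(3)]
        emeasure_Un_null_set)
qed

end
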